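(* Let $a,T>0$, $\Omega=(0,a)^3$, $Q=\Omega\times(0,T)$, let $\alpha_2>0$, and let $\omega_*,\omega^*,k_*$ be positive constants with $\omega_*\le\omega_0(x)\le\omega^*$ and $k_0(x)\ge k_*$ for a.a. $x\in\Omega$, where $\omega_0,k_0$ are the initial data. Let $\{\boldsymbol u,\omega,k\}$ be a weak solution of Kolmogorov's two-equation model as provided by the existence theorem recalled in the context (so that in particular the pointwise bounds stated there hold). Then, for a.a. $(x,t)\in Q$, $$L(x,t):=\frac{k(x,t)^{1/2}}{\omega(x,t)}\ \ge\ \frac{k_*^{1/2}}{\omega^*}\,(1+t\omega^* )^{1-\alpha_2/2},\qquad \frac1{\omega^*}+t\ \le\ \frac1{\omega(x,t)}\ \le\ \frac1{\omega_*}+t.$$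
   Context: Kolmogorov's two-equation model (normalized with $\nu_1=\nu_2=\alpha_1=1$) on $Q$ with space-periodic boundary conditions is $\mathrm{div}\,\boldsymbol u=0$, $\ \partial_t\boldsymbol u+(\boldsymbol u\cdot\nabla)\boldsymbol u=\nu_0\mathrm{div}(\frac k\omega\boldsymbol D(\boldsymbol u))-\nabla p+\boldsymbol f$, $\ \partial_t\omega+\boldsymbol u\cdot\nabla\omega=\mathrm{div}(\frac k\omega\nabla\omega)-\omega^2$, $\ \partial_tk+\boldsymbol u\cdot\nabla k=\mathrm{div}(\frac k\omega\nabla k)+\nu_0\frac k\omega|\boldsymbol D(\boldsymbol u)|^2-\alpha_2k\omega$, with initial data $\boldsymbol u_0,\omega_0,k_0$ and $\boldsymbol D(\boldsymbol u)=\frac12(\nabla\boldsymbol u+(\nabla\boldsymbol u)^\top)$, $\nu_0>0$. Existence theorem: if $\boldsymbol f\in\boldsymbol L^2(Q)$, $\boldsymbol u_0$ belongs to the $\boldsymbol L^2(\Omega)$-closure of smooth $a$-periodic divergence-free fields, $\omega_0\in L^\infty(\Omega)$ and $k_0\in L^1(\Omega)$ with $\omega_*\le\omega_0\le\omega^*$ and $k_0\ge k_*$ a.e., then there exists a weak solution $\{\boldsymbol u,\omega,k\}$ (with a non-negative defect measure in the $k$-equation) which satisfies for a.a. $(x,t)\in Q$ $$\frac{\omega_*}{1+t\omega_*}\le\omega(x,t)\le\frac{\omega^*}{1+t\omega^*},\qquad \frac{k_*}{(1+t\omega^* )^{\alpha_2}}\le k(x,t).$$ These pointwise bounds are the only property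 of the solution that the statement refers to. *)

theory Defs
  imports "HOL-Analysis.Analysis"
begin

definition \<Omega> :: "real \<Rightarrow> (real^3) set" where
  "\<Omega> a = {x. \<forall>i. 0 < x $ i \<and> x $ i < a}"

definition Q :: "real \<Rightarrow> real \<Rightarrow> ((real^3) \<times> real) set" where
  "Q a T = \<Omega> a \<times> {0<..<T}"

definition square_integrable_on_set ::
    "('a::euclidean_space \<Rightarrow> 'b::euclidean_space) \<Rightarrow> 'a set \<Rightarrow> bool" where
  "square_integrable_on_set g S \<longleftrightarrow>
     g \<in> borel_measurable (lebesgue_on S) \<and> integrable (lebesgue_on S) (\<lambda>x. (norm (g x))\<^sup>2)"

definition essentially_bounded_on :: "('a::euclidean_space \<Rightarrow> real) \<Rightarrow> 'a set \<Rightarrow> bool" where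
  "essentially_bounded_on g S \<longleftrightarrow>
     g \<in> borel_measurable (lebesgue_on S) \<and> (\<exists>C. AE x in lebesgue_on S. \<bar>g x\<bar> \<le> C)"

subsection \<open>Smooth periodic functions\<close>

fun times_differentiable ::
    "nat \<Rightarrow> ('a::euclidean_space \<Rightarrow> 'b::euclidean_space) \<Rightarrow> bool" where
  "times_differentiable 0 g \<longleftrightarrow> continuous_on UNIV g"
| "times_differentiable (Suc n) g \<longleftrightarrow>
     (\<forall>x. g differentiable at x) \<and>
     (\<forall>v. times_differentiable n (\<lambda>x. frechet_derivative g (at x) v))"

definition smooth :: "('a::euclidean_space \<Rightarrow> 'b::euclidean_space) \<Rightarrow> bool" where
  "smooth g \<longleftrightarrow> (\<forall>n. times_differentiable n g)"

definition space_periodic :: "real \<Rightarrow> (real^3 \<Rightarrow> 'b) \<Rightarrow> bool" where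
  "space_periodic a g \<longleftrightarrow> (\<forall>x i. g (x + axis i a) = g x)"

definition grad :: "(real^3 \<Rightarrow> real) \<Rightarrow> real^3 \<Rightarrow> real^3" where
  "grad g x = (\<chi> i. frechet_derivative g (at x) (axis i 1))"

definition divergence :: "(real^3 \<Rightarrow> real^3) \<Rightarrow> real^3 \<Rightarrow> real" where
  "divergence v x = trace (jacobian v (at x))"

text \<open>The closure in \<open>L\<^sup>2(\<Omega>)\<close> of the smooth \<open>a\<close>-periodic divergence-free fields.\<close>

definition solenoidal_L2 :: "real \<Rightarrow> (real^3 \<Rightarrow> real^3) \<Rightarrow> bool" where
  "solenoidal_L2 a g \<longleftrightarrow>
     square_integrable_on_set g (\<Omega> a) \<and>
     (\<forall>\<epsilon>>0. \<exists>v. smooth v \<and> space_periodic a v \<and> (\<forall>x. divergence v x = 0) \<and>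
        sqrt (LINT x|lebesgue_on (\<Omega> a). (norm (v x - g x))\<^sup>2) < \<epsilon>)"

definition test_function :: "real \<Rightarrow> ((real^3) \<times> real \<Rightarrow> 'b::euclidean_space) \<Rightarrow> bool" where
  "test_function a \<phi> \<longleftrightarrow> smooth \<phi> \<and> (\<forall>t. space_periodic a (\<lambda>x. \<phi> (x, t)))"

definition vanishes_at :: "real \<Rightarrow> ((real^3) \<times> real \<Rightarrow> 'b::zero) \<Rightarrow> bool" where
  "vanishes_at T \<phi> \<longleftrightarrow> (\<forall>x. \<phi> (x, T) = 0)"

subsection \<open>Weak solutions\<close>

text \<open>
  \<open>G\<close> is the weak spatial gradient of the space-periodic function \<open>g\<close> on \<open>Q\<close>.  The test
  functions are periodic and need not vanish on the boundary of \<open>\<Omega>\<close>; so the identity also says that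
  the traces of \<open>g\<close> on opposite faces of the cube agree.
\<close>

definition weak_gradient ::
    "real \<Rightarrow> real \<Rightarrow> ((real^3) \<times> real \<Rightarrow> real) \<Rightarrow> ((real^3) \<times> real \<Rightarrow> real^3) \<Rightarrow> bool" where
  "weak_gradient a T g G \<longleftrightarrow>
     integrable (lebesgue_on (Q a T)) g \<and> integrable (lebesgue_on (Q a T)) G \<and>
     (\<forall>\<phi>. test_function a \<phi> \<longrightarrow>
        (LINT (x, t)|lebesgue_on (Q a T). g (x, t) *\<^sub>R grad (\<lambda>y. \<phi> (y, t)) x)
        = - (LINT (x, t)|lebesgue_on (Q a T). \<phi> (x, t) *\<^sub>R G (x, t)))"

text \<open>\<open>U $ i $ j\<close> stands for \<open>\<partial>\<^sub>j u\<^sub>i\<close>.\<close>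

definition weak_jacobian ::
    "real \<Rightarrow> real \<Rightarrow> ((real^3) \<times> real \<Rightarrow> real^3) \<Rightarrow> ((real^3) \<times> real \<Rightarrow> real^3^3) \<Rightarrow> bool" where
  "weak_jacobian a T u U \<longleftrightarrow> (\<forall>i. weak_gradient a T (\<lambda>z. u z $ i) (\<lambda>z. U z $ i))"

definition symm_part :: "real^3^3 \<Rightarrow> real^3^3" where
  "symm_part A = (1/2) *\<^sub>R (A + transpose A)"

text \<open>
  The inner product of \<open>real^3^3\<close> is the Frobenius product \<open>A : B\<close>.  The pressure is eliminated by
  divergence-free test functions, and the convective term is integrated by parts:
  \<open>\<integral> ((u\<cdot>\<nabla>)u)\<cdot>v = - \<integral> u\<cdot>((\<nabla>v)u)\<close>.
\<close>

definition weak_momentum_equation where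
  "weak_momentum_equation a T \<nu>0 (f :: (real^3) \<times> real \<Rightarrow> real^3) (u0 :: real^3 \<Rightarrow> real^3) u U
       (\<omega> :: (real^3) \<times> real \<Rightarrow> real) (k :: (real^3) \<times> real \<Rightarrow> real) \<longleftrightarrow>
     square_integrable_on_set u (Q a T) \<and>
     integrable (lebesgue_on (Q a T)) (\<lambda>z. (k z / \<omega> z) *\<^sub>R symm_part (U z)) \<and>
     (\<forall>v. test_function a v \<and> vanishes_at T v \<and> (\<forall>x t. divergence (\<lambda>y. v (y, t)) x = 0) \<longrightarrow>
        - (LINT (x, t)|lebesgue_on (Q a T). u (x, t) \<bullet> vector_derivative (\<lambda>s. v (x, s)) (at t))
        - (LINT (x, t)|lebesgue_on (Q a T).
             u (x, t) \<bullet> (jacobian (\<lambda>y. v (y, t)) (at x) *v u (x, t)))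
        + \<nu>0 * (LINT (x, t)|lebesgue_on (Q a T). (k (x, t) / \<omega> (x, t))
             * (symm_part (U (x, t)) \<bullet> symm_part (jacobian (\<lambda>y. v (y, t)) (at x))))
        = (LINT x|lebesgue_on (\<Omega> a). u0 x \<bullet> v (x, 0))
        + (LINT z|lebesgue_on (Q a T). f z \<bullet> v z))"

definition weak_omega_equation where
  "weak_omega_equation a T (\<omega>0 :: real^3 \<Rightarrow> real) (u :: (real^3) \<times> real \<Rightarrow> real^3)
       (\<omega> :: (real^3) \<times> real \<Rightarrow> real) W (k :: (real^3) \<times> real \<Rightarrow> real) \<longleftrightarrow>
     integrable (lebesgue_on (Q a T)) (\<lambda>z. \<omega> z *\<^sub>R u z) \<and>
     integrable (lebesgue_on (Q a T)) (\<lambda>z. (k z / \<omega> z) *\<^sub>R W z) \<and>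
     integrable (lebesgue_on (Q a T)) (\<lambda>z. (\<omega> z)\<^sup>2) \<and>
     (\<forall>\<phi>. test_function a \<phi> \<and> vanishes_at T \<phi> \<longrightarrow>
        - (LINT x|lebesgue_on (\<Omega> a). \<omega>0 x * \<phi> (x, 0))
        - (LINT (x, t)|lebesgue_on (Q a T). \<omega> (x, t) * deriv (\<lambda>s. \<phi> (x, s)) t)
        - (LINT (x, t)|lebesgue_on (Q a T). \<omega> (x, t) * (u (x, t) \<bullet> grad (\<lambda>y. \<phi> (y, t)) x))
        + (LINT (x, t)|lebesgue_on (Q a T).
             (k (x, t) / \<omega> (x, t)) * (W (x, t) \<bullet> grad (\<lambda>y. \<phi> (y, t)) x))
        = - (LINT z|lebesgue_on (Q a T). (\<omega> z)\<^sup>2 * \<phi> z))"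

text \<open>\<open>\<mu>\<close> is the non-negative defect measure, a finite Borel measure on the closure of \<open>Q\<close>.\<close>

definition weak_k_equation where
  "weak_k_equation a T \<nu>0 \<alpha>2 (k0 :: real^3 \<Rightarrow> real) (u :: (real^3) \<times> real \<Rightarrow> real^3) U
       (\<omega> :: (real^3) \<times> real \<Rightarrow> real) (k :: (real^3) \<times> real \<Rightarrow> real) K \<mu> \<longleftrightarrow>
     sets \<mu> = sets (restrict_space borel (closure (Q a T))) \<and> finite_measure \<mu> \<and>
     integrable (lebesgue_on (Q a T)) (\<lambda>z. k z *\<^sub>R u z) \<and>
     integrable (lebesgue_on (Q a T)) (\<lambda>z. (k z / \<omega> z) *\<^sub>R K z) \<and>
     integrable (lebesgue_on (Q a T)) (\<lambda>z. (k z / \<omega> z) * (norm (symm_part (U z)))\<^sup>2) \<and>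
     integrable (lebesgue_on (Q a T)) (\<lambda>z. k z * \<omega> z) \<and>
     (\<forall>\<phi>. test_function a \<phi> \<and> vanishes_at T \<phi> \<longrightarrow>
        - (LINT x|lebesgue_on (\<Omega> a). k0 x * \<phi> (x, 0))
        - (LINT (x, t)|lebesgue_on (Q a T). k (x, t) * deriv (\<lambda>s. \<phi> (x, s)) t)
        - (LINT (x, t)|lebesgue_on (Q a T). k (x, t) * (u (x, t) \<bullet> grad (\<lambda>y. \<phi> (y, t)) x))
        + (LINT (x, t)|lebesgue_on (Q a T).
             (k (x, t) / \<omega> (x, t)) * (K (x, t) \<bullet> grad (\<lambda>y. \<phi> (y, t)) x))
        = (LINT z|lebesgue_on (Q a T).
             (\<nu>0 * (k z / \<omega> z) * (norm (symm_part (U z)))\<^sup>2 - \<alpha>2 * k z * \<omega> z) * \<phi> z)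
        + (LINT z|\<mu>. \<phi> z))"

text \<open>
  Only the integrability that gives every term a meaning is demanded; this is implied by any
  stronger choice of function spaces.
\<close>

definition weak_solution ::
    "real \<Rightarrow> real \<Rightarrow> real \<Rightarrow> real \<Rightarrow> ((real^3) \<times> real \<Rightarrow> real^3) \<Rightarrow>
     (real^3 \<Rightarrow> real^3) \<Rightarrow> (real^3 \<Rightarrow> real) \<Rightarrow> (real^3 \<Rightarrow> real) \<Rightarrow>
     ((real^3) \<times> real \<Rightarrow> real^3) \<Rightarrow> ((real^3) \<times> real \<Rightarrow> real) \<Rightarrow> ((real^3) \<times> real \<Rightarrow> real) \<Rightarrow> bool" where
  "weak_solution a T \<nu>0 \<alpha>2 f u0 \<omega>0 k0 u \<omega> k \<longleftrightarrow>
     (AE z in lebesgue_on (Q a T). 0 < \<omega> z \<and> 0 \<le> k z) \<and>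
     (\<exists>U W K \<mu>.
        weak_jacobian a T u U \<and> weak_gradient a T \<omega> W \<and> weak_gradient a T k K \<and>
        (AE z in lebesgue_on (Q a T). trace (U z) = 0) \<and>
        weak_momentum_equation a T \<nu>0 f u0 u U \<omega> k \<and>
        weak_omega_equation a T \<omega>0 u \<omega> W k \<and>
        weak_k_equation a T \<nu>0 \<alpha>2 k0 u U \<omega> k K \<mu>)"

end

theory Submission
  imports Defs
begin

text \<open>The claim is pointwise algebra at almost every \<open>(x, t)\<close>. The decay bounds
  for \<omega> have the form \<open>m / (1 + t * m)\<close>, whose reciprocal is
  \<open>1 / m + t\<close>; inverting them reverses the order and gives the affine bounds on
  \<open>1 / \<omega>\<close> (\<open>reciprocal_bounds_from_decay_bounds\<close>). With b = 1 + t *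
  \<omega>max, the lower one reads 1 / \<omega> >= b / \<omega>max, while the square root of the
  bound on \<open>k\<close> decays like b to the power -\<alpha>2/2
  (\<open>sqrt_ge_of_powr_decay\<close>). Multiplying the two adds the exponents to 1 - \<alpha>2/2
  (\<open>length_scale_bound\<close>).\<close>

lemma reciprocal_bounds_from_decay_bounds:
  fixes w m M t :: real
  assumes "0 < m" "0 < M" "0 \<le> t"
    and lower: "m / (1 + t * m) \<le> w" and upper: "w \<le> M / (1 + t * M)"
  shows "1 / M + t \<le> 1 / w" and "1 / w \<le> 1 / m + t"
proof -
  have m: "0 < 1 + t * m" and M: "0 < 1 + t * M"
    using assms by (simp_all add: add_pos_nonneg)
  \<comment> \<open>Inverting the inequalities requires a positive \<open>w\<close>; the positive
    lower bound supplies this.\<close>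
  have "0 < w"
    using lower m \<open>0 < m\<close> by (meson divide_pos_pos less_le_trans)
  then show "1 / M + t \<le> 1 / w" "1 / w \<le> 1 / m + t"
    using lower upper m M \<open>0 < m\<close> \<open>0 < M\<close> by (simp_all add: field_simps)
qed

lemma sqrt_ge_of_powr_decay:
  fixes c b \<alpha> x :: real
  assumes "0 \<le> c" "0 < b" and "c / b powr \<alpha> \<le> x"
  shows "sqrt c * b powr (- \<alpha> / 2) \<le> sqrt x"
proof -
  have "sqrt (b powr \<alpha>) = b powr (\<alpha> / 2)"
    by (simp add: powr_half_sqrt[symmetric] powr_powr)
  then have "sqrt c * b powr (- \<alpha> / 2) = sqrt (c / b powr \<alpha>)"
    by (simp add: real_sqrt_divide powr_minus_divide)
  also have "\<dots> \<le> sqrt x"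
    using assms(3) by simp
  finally show ?thesis .
qed

text \<open>The bound on \<open>w\<close> enters in reciprocal form because the length scale is the
  product of \<open>sqrt k\<close> and \<open>1 / w\<close>, each bounded below by a power of the
  same base.\<close>

lemma length_scale_bound:
  fixes w k M c \<alpha> t :: real
  assumes "0 < M" "0 \<le> c" "0 \<le> t"
    and w: "1 / M + t \<le> 1 / w" and k: "c / (1 + t * M) powr \<alpha> \<le> k"
  shows "sqrt c / M * (1 + t * M) powr (1 - \<alpha> / 2) \<le> sqrt k / w"
proof -
  define b where "b = 1 + t * M"
  have b: "0 < b"
    using assms by (simp add: b_def add_pos_nonneg)
  have bw: "b / M \<le> 1 / w"
    using w \<open>0 < M\<close> by (simp add: b_def add_divide_distrib)
  have sq: "sqrt c * b powr (- \<alpha> / 2) \<le> sqrt k"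
    using \<open>0 \<le> c\<close> b k by (intro sqrt_ge_of_powr_decay) (simp_all add: b_def)
  \<comment> \<open>One full power of the base is split off for the factor \<open>1 / w\<close>;
    positivity of \<open>b\<close> gives \<open>b powr 1 = b\<close>.\<close>
  have "b powr (1 - \<alpha> / 2) = b powr (- \<alpha> / 2) * b"
    using b powr_add[of b "- \<alpha> / 2" 1] by simp
  then have "sqrt c / M * b powr (1 - \<alpha> / 2) = (sqrt c * b powr (- \<alpha> / 2)) * (b / M)"
    by simp
  also have "\<dots> \<le> sqrt k * (1 / w)"
    using sq bw
  proof (rule mult_mono)
    \<comment> \<open>\<open>sqrt\<close> is negative at negative arguments, so the sign is read off
      from the nonnegative lower bound in \<open>sq\<close>.\<close>
    show "0 \<le> sqrt k"
      using sq \<open>0 \<le> c\<close> by (meson mult_nonneg_nonneg order_trans powr_ge_zero real_sqrt_ge_zero)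
    show "0 \<le> b / M"
      using b \<open>0 < M\<close> by simp
  qed
  finally show ?thesis
    by (simp add: b_def)
qed

theorem corollary4p4:
  fixes a T \<nu>0 \<alpha>2 \<omega>min \<omega>max kmin :: real
    and f u :: "(real^3) \<times> real \<Rightarrow> real^3"
    and \<omega> k :: "(real^3) \<times> real \<Rightarrow> real"
    and u0 :: "real^3 \<Rightarrow> real^3"
    and \<omega>0 k0 :: "real^3 \<Rightarrow> real"
  assumes "a > 0" and "T > 0" and "\<nu>0 > 0" and "\<alpha>2 > 0"
    and "\<omega>min > 0" and "\<omega>max > 0" and "kmin > 0"
    and "square_integrable_on_set f (Q a T)"
    and "solenoidal_L2 a u0"
    and "essentially_bounded_on \<omega>0 (\<Omega> a)"
    and "integrable (lebesgue_on (\<Omega> a)) k0"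
    and "AE x in lebesgue_on (\<Omega> a). \<omega>min \<le> \<omega>0 x \<and> \<omega>0 x \<le> \<omega>max"
    and "AE x in lebesgue_on (\<Omega> a). k0 x \<ge> kmin"
    and "weak_solution a T \<nu>0 \<alpha>2 f u0 \<omega>0 k0 u \<omega> k"
    and "AE (x, t) in lebesgue_on (Q a T).
           \<omega>min / (1 + t * \<omega>min) \<le> \<omega> (x, t) \<and> \<omega> (x, t) \<le> \<omega>max / (1 + t * \<omega>max)"
    and "AE (x, t) in lebesgue_on (Q a T).
           kmin / (1 + t * \<omega>max) powr \<alpha>2 \<le> k (x, t)"
  shows "AE (x, t) in lebesgue_on (Q a T).
           sqrt (k (x, t)) / \<omega> (x, t) \<ge> sqrt kmin / \<omega>max * (1 + t * \<omega>max) powr (1 - \<alpha>2 / 2) \<and>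
           1 / \<omega>max + t \<le> 1 / \<omega> (x, t) \<and> 1 / \<omega> (x, t) \<le> 1 / \<omega>min + t"
proof -
  \<comment> \<open>Positivity of time comes from membership in \<open>Q a T\<close>; it makes the
    denominators \<open>1 + t * \<omega>min\<close> and \<open>1 + t * \<omega>max\<close>
    positive.\<close>
  have "AE z in lebesgue_on (Q a T). 0 < snd z"
    by (rule AE_I2) (auto simp: Q_def)
  with assms(15,16) show ?thesis
  proof eventually_elim
    case (elim z)
    obtain x t where z: "z = (x, t)"
      by (cases z)
    have t: "0 \<le> t"
      and w: "\<omega>min / (1 + t * \<omega>min) \<le> \<omega> (x, t)" "\<omega> (x, t) \<le> \<omega>max / (1 + t * \<omega>max)"
      and k: "kmin / (1 + t * \<omega>max) powr \<alpha>2 \<le> k (x, t)"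
      using elim by (auto simp: z)
    note recip = reciprocal_bounds_from_decay_bounds[OF \<open>\<omega>min > 0\<close> \<open>\<omega>max > 0\<close> t w]
    show ?case
      using length_scale_bound[OF \<open>\<omega>max > 0\<close> less_imp_le[OF \<open>kmin > 0\<close>] t recip(1) k] recip
      by (simp add: z)
  qed
qed

end
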